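(* Let $a,b$ be positive integers. There exists at most one regular configuration in $\mathrm{CONF}(a,b)$.
   Context: For nonnegative integers $a,b$, $\mathrm{CONF}(a,b)$ denotes the set of necklaces, i.e. circular arrangements up to rotation, of $a$ red beads and $b$ black beads. For $\Delta\in\mathrm{CONF}(a,b)$ with $b>0$, label the black beads $B_0,\dots,B_{b-1}$ consecutively around the circle and let $x_i$ be the number of red beads between $B_i$ and $B_{i+1}$ (indices mod $b$). The sequence $\{x_0,\dots,x_{b-1}\}$ is a characteristic sequence of $\Delta$; it has sum $a$ and is determined by $\Delta$ up to cyclic shift. Two configurations are equal if and only if their characteristic sequences are cyclic shifts of each other. $\Delta$ is regular if its characteristic sequence satisfies $\frac{a}{b}k-1 < x_i+x_{i+1}+\dots+x_{i+k-1} < \frac{a}{b}k+1$ for all $0\le i\le b-1$ and $1\le k\le 1+\lfloor b/2\rfloor$, with indices mod $b$. *)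

theory Defs
  imports Complex_Main
begin

datatype bead = Red | Black

definition bead_words :: "nat \<Rightarrow> nat \<Rightarrow> bead list set" where
  "bead_words a b = {w. count_list w Red = a \<and> count_list w Black = b}"

definition rotation_rel :: "(bead list \<times> bead list) set" where
  "rotation_rel = {(u, v). \<exists>n. v = rotate n u}"

text \<open>A necklace is the set of all its readings, i.e. a class of words modulo rotation
  (reflections are not identified).\<close>

definition CONF :: "nat \<Rightarrow> nat \<Rightarrow> bead list set set" where
  "CONF a b = bead_words a b // rotation_rel"

text \<open>The word read off the circle when starting at the black bead \<open>B\<^sub>0\<close>:
  \<open>B\<^sub>0\<close>, then \<open>x\<^sub>0\<close> red beads, then \<open>B\<^sub>1\<close>, then \<open>x\<^sub>1\<close> red beads, and so on, where
  the last \<open>x\<close> counts the red beads between the last black bead and \<open>B\<^sub>0\<close>.\<close>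

definition gap_word :: "nat list \<Rightarrow> bead list" where
  "gap_word xs = concat (map (\<lambda>x. Black # replicate x Red) xs)"

definition characteristic_sequence :: "bead list set \<Rightarrow> nat list \<Rightarrow> bool" where
  "characteristic_sequence \<Delta> xs \<longleftrightarrow> gap_word xs \<in> \<Delta>"

text \<open>For a necklace in \<open>CONF a b\<close> with \<open>b > 0\<close> a characteristic sequence exists, has length
  \<open>b\<close>, and is unique up to cyclic shift (lemmas below); as the inequalities range over all
  \<open>i < b\<close>, they do not depend on the sequence chosen.\<close>

definition regular :: "nat \<Rightarrow> nat \<Rightarrow> bead list set \<Rightarrow> bool" where
  "regular a b \<Delta> \<longleftrightarrow>
     (\<exists>xs. characteristic_sequence \<Delta> xs \<and>
        (\<forall>i<b. \<forall>k\<in>{1..1 + b div 2}.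
           real a / real b * real k - 1 < real (\<Sum>j<k. xs ! ((i + j) mod b)) \<and>
           real (\<Sum>j<k. xs ! ((i + j) mod b)) < real a / real b * real k + 1))"

lemma count_list_rotate: "count_list (rotate n w) x = count_list w x"
proof (induction n)
  case (Suc n)
  have "count_list (rotate1 v) x = count_list v x" for v :: "'a list"
    by (cases v) auto
  with Suc show ?case by simp
qed simp

lemma equiv_rotation_rel: "equiv UNIV rotation_rel"
proof (rule equivI)
  show "refl rotation_rel"
    unfolding refl_on_def rotation_rel_def by (auto intro: exI[of _ 0])
  show "sym rotation_rel"
  proof (rule symI)
    fix u v assume "(u, v) \<in> rotation_rel"
    then obtain n where v: "v = rotate n u" by (auto simp: rotation_rel_def)
    define m where "m = n mod length u"
    have v: "v = rotate m u" using v by (simp add: m_def rotate_conv_mod[of n u])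
    have "u = rotate (length u - m) v"
    proof (cases "u = []")
      case False
      then have "m \<le> length u" by (simp add: m_def less_imp_le)
      then show ?thesis by (simp add: v rotate_rotate)
    qed (simp add: v)
    then show "(v, u) \<in> rotation_rel" by (auto simp: rotation_rel_def)
  qed
  show "trans rotation_rel"
    by (rule transI) (auto simp: rotation_rel_def rotate_rotate)
qed simp

lemma count_gap_word:
  "count_list (gap_word xs) Red = sum_list xs" "count_list (gap_word xs) Black = length xs"
proof -
  have r: "count_list (replicate n Red) Red = n" "count_list (replicate n Red) Black = 0" for n
    by (induction n) auto
  show "count_list (gap_word xs) Red = sum_list xs" "count_list (gap_word xs) Black = length xs"
    by (induction xs) (auto simp: gap_word_def r)
qed

lemma characteristic_sequence_length_sum:
  assumes "\<Delta> \<in> CONF a b" "characteristic_sequence \<Delta> xs"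
  shows "length xs = b" "sum_list xs = a"
proof -
  obtain w n where "w \<in> bead_words a b" "gap_word xs = rotate n w"
    using assms by (auto simp: CONF_def characteristic_sequence_def rotation_rel_def quotient_def)
  then show "length xs = b" "sum_list xs = a"
    using count_gap_word[of xs] by (simp_all add: bead_words_def count_list_rotate)
qed

lemma gap_word_exists: "\<exists>m xs. w = replicate m Red @ gap_word xs"
proof (induction w)
  case Nil
  show ?case by (rule exI[of _ 0], rule exI[of _ "[]"]) (simp add: gap_word_def)
next
  case (Cons c w)
  then obtain m xs where w: "w = replicate m Red @ gap_word xs" by blast
  show ?case
  proof (cases c)
    case Red
    then show ?thesis using w by (intro exI[of _ "Suc m"] exI[of _ xs]) simp
  next
    case Black
    then show ?thesis using w
      by (intro exI[of _ 0] exI[of _ "m # xs"]) (simp add: gap_word_def)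
  qed
qed

lemma characteristic_sequence_exists:
  assumes "\<Delta> \<in> CONF a b" "b > 0"
  shows "\<exists>xs. characteristic_sequence \<Delta> xs"
proof -
  obtain w where w: "w \<in> bead_words a b" "\<Delta> = rotation_rel `` {w}"
    using assms by (auto simp: CONF_def quotient_def)
  obtain m xs where e: "w = replicate m Red @ gap_word xs" using gap_word_exists by blast
  have "count_list (replicate m Red) Black = 0" by (induction m) auto
  then have "length xs = b" using w(1) e count_gap_word(2)[of xs] by (simp add: bead_words_def)
  with assms obtain ys y where xs: "xs = ys @ [y]" by (cases xs rule: rev_cases) auto
  have "rotate m w = gap_word xs @ replicate m Red"
    using rotate_append[of "replicate m Red" "gap_word xs"] by (simp add: e)
  also have "\<dots> = gap_word (ys @ [y + m])" by (simp add: gap_word_def xs replicate_add)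
  finally show ?thesis
    unfolding characteristic_sequence_def w(2) rotation_rel_def by (auto intro: sym)
qed

lemma gap_word_inject:
  "replicate m Red @ gap_word xs = replicate n Red @ gap_word ys \<Longrightarrow> m = n \<and> xs = ys"
proof (induction xs arbitrary: m n ys)
  case Nil
  then have "count_list (replicate m Red @ gap_word []) Black
    = count_list (replicate n Red @ gap_word ys) Black" by simp
  moreover have "count_list (replicate k Red) Black = 0" for k by (induction k) auto
  ultimately have "ys = []" using count_gap_word(2)[of ys] by (simp add: gap_word_def)
  then show ?case using Nil by (simp add: gap_word_def)
next
  case (Cons x xs)
  have "count_list (replicate m Red @ gap_word (x # xs)) Black
    = count_list (replicate n Red @ gap_word ys) Black" using Cons.prems by simp
  moreover have "count_list (replicate k Red) Black = 0" for k by (induction k) auto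
  ultimately obtain y zs where ys: "ys = y # zs" 
    using count_gap_word(2)[of ys] count_gap_word(2)[of "x # xs"] by (cases ys) auto
  have tw: "takeWhile (\<lambda>c. c = Red) (replicate k Red @ Black # r) = replicate k Red"
    "dropWhile (\<lambda>c. c = Red) (replicate k Red @ Black # r) = Black # r" for k r
    by (induction k) auto
  have eq: "replicate m Red @ Black # replicate x Red @ gap_word xs
      = replicate n Red @ Black # replicate y Red @ gap_word zs"
    using Cons.prems by (simp add: ys gap_word_def)
  have "m = n" using arg_cong[OF eq, of "takeWhile (\<lambda>c. c = Red)"] by (simp add: tw replicate_eq_replicate)
  moreover from this eq have "replicate x Red @ gap_word xs = replicate y Red @ gap_word zs" by simp
  ultimately show ?case using Cons.IH ys by blast
qed

lemma rotate1_iter_gap_word: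
  "\<exists>m x zs k. rotate n (gap_word (x0 # xs0)) = replicate m Red @ gap_word (zs @ [x])
     \<and> rotate k (x0 # xs0) = zs @ [x + m]"
proof (induction n)
  case 0
  obtain zs x where "x0 # xs0 = zs @ [x]" by (cases "x0 # xs0" rule: rev_cases) auto
  then show ?case by (intro exI[of _ 0] exI[of _ x] exI[of _ zs]) simp
next
  case (Suc n)
  then obtain m x zs k where
    h: "rotate n (gap_word (x0 # xs0)) = replicate m Red @ gap_word (zs @ [x])"
       "rotate k (x0 # xs0) = zs @ [x + m]" by blast
  show ?case
  proof (cases m)
    case 0
    obtain y ys where y: "zs @ [x] = y # ys" by (cases zs) auto
    have "rotate (Suc n) (gap_word (x0 # xs0)) = replicate y Red @ gap_word (ys @ [0])"
      using h(1) by (simp add: 0 y gap_word_def)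
    moreover have "rotate (Suc k) (x0 # xs0) = ys @ [0 + y]" using h(2) by (simp add: 0 y)
    ultimately show ?thesis by blast
  next
    case (Suc m')
    have "rotate (Suc n) (gap_word (x0 # xs0)) = replicate m' Red @ gap_word (zs @ [Suc x])"
      using h(1) by (simp add: Suc gap_word_def replicate_append_same)
    moreover have "rotate k (x0 # xs0) = zs @ [Suc x + m']" using h(2) by (simp add: Suc)
    ultimately show ?thesis by blast
  qed
qed

lemma characteristic_sequence_unique:
  assumes "\<Delta> \<in> CONF a b" "b > 0" "characteristic_sequence \<Delta> xs" "characteristic_sequence \<Delta> ys"
  shows "\<exists>k. ys = rotate k xs"
proof -
  obtain w where w: "\<Delta> = rotation_rel `` {w}"
    using assms by (auto simp: CONF_def quotient_def)
  have "(w, gap_word xs) \<in> rotation_rel" "(w, gap_word ys) \<in> rotation_rel"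
    using assms(3,4) by (auto simp: w characteristic_sequence_def)
  then have "(gap_word xs, gap_word ys) \<in> rotation_rel"
    using equiv_rotation_rel by (meson equivE symE transE)
  then obtain n where n: "gap_word ys = rotate n (gap_word xs)" by (auto simp: rotation_rel_def)
  obtain x0 xs0 where xs: "xs = x0 # xs0"
    using characteristic_sequence_length_sum(1)[OF assms(1,3)] assms(2) by (cases xs) auto
  obtain m x zs k where
    h: "gap_word ys = replicate m Red @ gap_word (zs @ [x])" "rotate k xs = zs @ [x + m]"
    using rotate1_iter_gap_word[of n x0 xs0] n xs by auto
  then have "m = 0 \<and> ys = zs @ [x]" using gap_word_inject[of 0 ys m "zs @ [x]"] by simp
  then show ?thesis using h(2) by (intro exI[of _ k]) simp
qed

end

theory Submission
  imports Defs
begin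

text \<open>
  Extend the characteristic sequence periodically, let \<open>S n\<close> be its partial sums and consider the
  discrepancy \<open>D n = b S n - a n\<close>. It has period \<open>b\<close>, so the regularity condition for a window of
  length \<open>k\<close> is equivalent to that for the complementary window of length \<open>b - k\<close>; hence any two
  values of \<open>D\<close> differ by less than \<open>b\<close>. Starting the reading at a minimum of \<open>D\<close> gives
  \<open>a k \<le> b W k < a k + b\<close> for the sum \<open>W k\<close> of the first \<open>k\<close> gaps, so \<open>W k = \<lceil>a k / b\<rceil>\<close>. Every
  regular configuration therefore has one and the same characteristic sequence.
\<close>

lemma trans_rotation_rel: "trans rotation_rel"
  using equiv_rotation_rel by (simp add: equiv_def)

text \<open>Moving the first gap to the end of the sequence moves a whole block, one black bead and
  its red beads, to the end of the word.\<close>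

lemma gap_word_rotate: "(gap_word xs, gap_word (rotate n xs)) \<in> rotation_rel"
proof (induction n)
  case 0
  show ?case by (auto simp: rotation_rel_def intro: exI[of _ 0])
next
  case (Suc n)
  have "(gap_word ys, gap_word (rotate1 ys)) \<in> rotation_rel" for ys
  proof (cases ys)
    case Nil
    then show ?thesis by (auto simp: rotation_rel_def intro: exI[of _ 0])
  next
    case (Cons y zs)
    \<comment> \<open>\<open>Suc y\<close> is the length of the first block: the black bead and
      \<open>y\<close> red ones.\<close>
    have "rotate (Suc y) (gap_word ys) = gap_word (rotate1 ys)"
      using rotate_append[of "Black # replicate y Red" "gap_word zs"]
      by (simp add: Cons gap_word_def del: rotate_Suc)
    then show ?thesis unfolding rotation_rel_def
      by (intro CollectI case_prodI exI[of _ "Suc y"]) (rule sym)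
  qed
  from transD[OF trans_rotation_rel Suc this] show ?case by simp
qed

lemma characteristic_sequence_rotate:
  assumes "\<Delta> \<in> CONF a b" "characteristic_sequence \<Delta> xs"
  shows "characteristic_sequence \<Delta> (rotate n xs)"
proof -
  obtain w where w: "\<Delta> = rotation_rel `` {w}"
    using assms(1) by (auto simp: CONF_def quotient_def)
  then have "(w, gap_word xs) \<in> rotation_rel"
    using assms(2) by (simp add: characteristic_sequence_def)
  then have "(w, gap_word (rotate n xs)) \<in> rotation_rel"
    using gap_word_rotate by (rule transD[OF trans_rotation_rel])
  then show ?thesis by (simp add: w characteristic_sequence_def)
qed

text \<open>Both necklaces are equivalence classes containing \<open>gap_word xs\<close>, and
  distinct classes are disjoint.\<close>

lemma CONF_eqI:
  assumes "\<Delta> \<in> CONF a b" "\<Gamma> \<in> CONF a b"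
    and "characteristic_sequence \<Delta> xs" "characteristic_sequence \<Gamma> xs"
  shows "\<Delta> = \<Gamma>"
proof -
  have "\<Delta> \<in> UNIV // rotation_rel" "\<Gamma> \<in> UNIV // rotation_rel"
    using assms(1,2) by (auto simp: CONF_def quotient_def)
  then show ?thesis
    using quotient_disj[OF equiv_rotation_rel] assms(3,4)
    by (auto simp: characteristic_sequence_def)
qed

definition window_sum :: "nat list \<Rightarrow> nat \<Rightarrow> nat \<Rightarrow> nat" where
  "window_sum xs i k = (\<Sum>j<k. xs ! ((i + j) mod length xs))"

lemma window_sum_add: "window_sum xs i (k + l) = window_sum xs i k + window_sum xs (i + k) l"
  by (induction l) (simp_all add: window_sum_def add.assoc)

lemma window_sum_mod: "window_sum xs (i mod length xs) k = window_sum xs i k"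
  by (simp add: window_sum_def mod_add_left_eq)

lemma window_sum_length: "window_sum xs 0 (length xs) = sum_list xs"
  by (simp add: window_sum_def sum_list_sum_nth atLeast0LessThan)

lemma window_sum_period:
  "window_sum xs 0 (n + length xs) = window_sum xs 0 n + sum_list xs"
  using window_sum_add[of xs 0 "length xs" n] window_sum_mod[of xs "length xs" n]
  by (simp add: window_sum_length add.commute)

text \<open>Recovers the gaps from the window sums. The truncated subtraction is exact, since the
  longer window contains the shorter one.\<close>

lemma nth_rotate_window_sum:
  assumes "k < length xs"
  shows "rotate i xs ! k = window_sum xs i (Suc k) - window_sum xs i k"
  using assms by (simp add: window_sum_def nth_rotate)

text \<open>The regularity inequalities multiplied by \<open>b\<close>, so that they become integer
  inequalities without division.\<close>

definition regular_sequence :: "nat list \<Rightarrow> bool" where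
  "regular_sequence xs \<longleftrightarrow> (\<forall>i<length xs. \<forall>k\<in>{1..1 + length xs div 2}.
     \<bar>int (length xs * window_sum xs i k) - int (sum_list xs * k)\<bar> < int (length xs))"

lemma regular_sequence_exists:
  assumes "\<Delta> \<in> CONF a b" "b > 0" "regular a b \<Delta>"
  shows "\<exists>xs. characteristic_sequence \<Delta> xs \<and> regular_sequence xs"
proof -
  obtain xs where xs: "characteristic_sequence \<Delta> xs"
    and reg: "\<And>i k. i < b \<Longrightarrow> k \<in> {1..1 + b div 2} \<Longrightarrow>
       real a / real b * real k - 1 < real (\<Sum>j<k. xs ! ((i + j) mod b)) \<and>
       real (\<Sum>j<k. xs ! ((i + j) mod b)) < real a / real b * real k + 1"
    using assms(3) unfolding regular_def by blast
  note len = characteristic_sequence_length_sum[OF assms(1) xs]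
  have "\<bar>int (b * window_sum xs i k) - int (a * k)\<bar> < int b"
    if "i < b" "k \<in> {1..1 + b div 2}" for i k
  proof -
    define W where "W = real (window_sum xs i k)"
    have "real a / real b * real k - 1 < W" "W < real a / real b * real k + 1"
      using reg[OF that] by (simp_all only: W_def window_sum_def len)
    then have "real a * real k - real b < real b * W" "real b * W < real a * real k + real b"
      using assms(2) by (simp_all add: field_simps)
    then have "real_of_int \<bar>int (b * window_sum xs i k) - int (a * k)\<bar> < real_of_int (int b)"
      by (simp add: W_def abs_less_iff)
    then show ?thesis by (simp only: of_int_less_iff)
  qed
  then show ?thesis using xs by (auto simp: regular_sequence_def len)
qed

lemma regular_sequence_window:
  assumes "regular_sequence xs" "xs \<noteq> []"
  shows "\<exists>i. \<forall>k\<le>length xs. sum_list xs * k \<le> length xs * window_sum xs i k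
     \<and> length xs * window_sum xs i k < sum_list xs * k + length xs"
proof -
  define a b where "a = sum_list xs" and "b = length xs"
  have b: "b > 0" using assms(2) by (simp add: b_def)
  define D where "D n = int (b * window_sum xs 0 n) - int (a * n)" for n
  have D_window: "D (i + k) - D i = int (b * window_sum xs i k) - int (a * k)" for i k
    by (simp add: D_def window_sum_add algebra_simps)
  have D_period: "D (n + b) = D n" for n
    using window_sum_period[of xs n, folded a_def b_def] by (simp add: D_def algebra_simps)
  have D_period_mult: "D (n + q * b) = D n" for n q
  proof (induction q)
    case (Suc q)
    then show ?case using D_period[of "n + q * b"] by (simp add: add_ac)
  qed simp
  have D_mod: "D (n mod b) = D n" for n
    using D_period_mult[of "n mod b" "n div b"] by simp
  have short: "\<bar>D (i + k) - D i\<bar> < int b" if "k \<le> 1 + b div 2" for i k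
  proof (cases "k = 0")
    case False
    \<comment> \<open>The hypothesis covers only starting positions below \<open>b\<close>, so
      \<open>i\<close> is reduced first; this does not change the window sum.\<close>
    then have "\<bar>int (b * window_sum xs (i mod b) k) - int (a * k)\<bar> < int b"
      using assms(1) b that by (auto simp: regular_sequence_def a_def b_def)
    then show ?thesis by (simp add: D_window window_sum_mod b_def)
  qed (use b in simp)
  have D_close: "\<bar>D (i + k) - D i\<bar> < int b" if "k \<le> b" for i k
  proof (cases "k \<le> 1 + b div 2")
    case False
    \<comment> \<open>The complementary window is short enough for \<open>short\<close>, and it ends
      at \<open>i + b\<close>, where \<open>D\<close> again has the value
      \<open>D i\<close>.\<close>
    then have "\<bar>D (i + k + (b - k)) - D (i + k)\<bar> < int b"
      by (intro short) linarith
    then show ?thesis using that by (simp add: D_period abs_minus_commute)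
  qed (use short in blast)
  \<comment> \<open>A minimum over one period is a minimum of \<open>D\<close> everywhere.\<close>
  obtain i where i: "\<And>n. n < b \<Longrightarrow> D i \<le> D n"
    using b ex_min_if_finite[of "D ` {..<b}"] by (auto simp: not_less)
  have "D i \<le> D n" for n
    using i[of "n mod b"] b by (simp add: D_mod)
  then have "0 \<le> D (i + k) - D i \<and> D (i + k) - D i < int b" if "k \<le> b" for k
    using D_close[OF that, of i] by (simp add: abs_less_iff)
  then have "\<forall>k\<le>b. a * k \<le> b * window_sum xs i k \<and> b * window_sum xs i k < a * k + b"
    unfolding D_window by (auto simp: less_diff_eq diff_less_eq add.commute simp flip: of_nat_add of_nat_mult)
  then show ?thesis by (auto simp: a_def b_def)
qed

lemma regular_sequence_unique:
  assumes "regular_sequence xs" "regular_sequence ys"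
    and len: "length xs = length ys" and sum: "sum_list xs = sum_list ys"
  shows "\<exists>i j. rotate i xs = rotate j ys"
proof (cases "xs = []")
  case False
  define a b where "a = sum_list xs" and "b = length xs"
  obtain i where i: "\<And>k. k \<le> b \<Longrightarrow> a * k \<le> b * window_sum xs i k
      \<and> b * window_sum xs i k < a * k + b"
    using regular_sequence_window[OF assms(1) False] by (auto simp: a_def b_def)
  obtain j where j: "\<And>k. k \<le> b \<Longrightarrow> a * k \<le> b * window_sum ys j k
      \<and> b * window_sum ys j k < a * k + b"
  proof -
    have "ys \<noteq> []" using False len by auto
    from regular_sequence_window[OF assms(2) this] show ?thesis
      using that by (auto simp: a_def b_def len sum)
  qed
  \<comment> \<open>A half-open interval of length 1 contains at most one integer; with
    \<open>c = a * k\<close>, applied in both directions, this forces the two window sums to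
    agree.\<close>
  have determined: "u \<le> v" if "b * u < c + b" "c \<le> b * v" for u v c :: nat
  proof -
    have "b * u < b * Suc v" using that by simp
    then show ?thesis by (simp only: mult_less_cancel1 less_Suc_eq_le)
  qed
  have W: "window_sum xs i k = window_sum ys j k" if "k \<le> b" for k
    using i[OF that] j[OF that] by (blast intro: antisym dest: determined)
  \<comment> \<open>Each entry is a difference of consecutive window sums; the last one uses the
    full window \<open>Suc k = b\<close>.\<close>
  have "rotate i xs ! k = rotate j ys ! k" if "k < b" for k
    using that W[of k] W[of "Suc k"] len by (simp add: nth_rotate_window_sum b_def)
  then have "rotate i xs = rotate j ys"
    using len by (intro nth_equalityI) (simp_all add: b_def)
  then show ?thesis by blast
qed (use len in simp)

theorem theorem2:
  fixes a b :: nat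
  assumes "a > 0" and "b > 0"
  shows "\<exists>\<^sub>\<le>\<^sub>1 \<Delta>. \<Delta> \<in> CONF a b \<and> regular a b \<Delta>"
proof (rule Uniq_I)
  fix \<Delta> \<Gamma>
  assume "\<Delta> \<in> CONF a b \<and> regular a b \<Delta>" "\<Gamma> \<in> CONF a b \<and> regular a b \<Gamma>"
  then have conf: "\<Delta> \<in> CONF a b" "\<Gamma> \<in> CONF a b"
    and reg: "regular a b \<Delta>" "regular a b \<Gamma>" by auto
  obtain xs ys where xs: "characteristic_sequence \<Delta> xs" "regular_sequence xs"
    and ys: "characteristic_sequence \<Gamma> ys" "regular_sequence ys"
    using regular_sequence_exists conf reg assms(2) by meson
  obtain i j where "rotate i xs = rotate j ys"
    using regular_sequence_unique[OF xs(2) ys(2)]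
      characteristic_sequence_length_sum[OF conf(1) xs(1)]
      characteristic_sequence_length_sum[OF conf(2) ys(1)] by auto
  then show "\<Gamma> = \<Delta>"
    using CONF_eqI[OF conf] characteristic_sequence_rotate[OF conf(1) xs(1)]
      characteristic_sequence_rotate[OF conf(2) ys(1)] by metis
qed

end
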